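(* Let $2\mathbf{Z}_8=\langle\{0,2,4,6\};+,\cdot,0\rangle$ be the subring of even elements of the ring $\mathbf{Z}_8$ of integers modulo $8$ (addition and multiplication modulo $8$). Then $2\mathbf{Z}_8$ is not dualizable, i.e. it does not admit a natural duality.
   Context: Natural dualities. Let $\mathbf{A}$ be a finite algebra with underlying set $A$. Consider topological structures $\tilde{A}=\langle A;F,H,R,\tau\rangle$ where: (a) each $f\in F$ is a homomorphism $f:\mathbf{A}^n\to\mathbf{A}$ for some $n\in\mathbb{N}\cup\{0\}$; (b) each $h\in H$ is a homomorphism $h:\mathrm{dom}(h)\to\mathbf{A}$, where $\mathrm{dom}(h)$ is a subalgebra of $\mathbf{A}^n$ for some $n\in\mathbb{N}$; (c) each $r\in R$ is the universe of a subalgebra of $\mathbf{A}^n$ for some $n\in\mathbb{N}$; (d) $\tau$ is the discrete topology. When (a), (b), (c) hold, the members of $F$, $H$, $R$ are said to be algebraic over $\mathbf{A}$. Let $\mathcal{A}=\mathbb{ISP}(\mathbf{A})$ be the quasivariety generated by $\mathbf{A}$ (isomorphic copies of subalgebras of direct powers of $\mathbf{A}$), and let $\mathcal{X}=\mathbb{IS}_c\mathbb{P}(\tilde{A})$ be the class of isomorphic copies of topologically closed substructures of direct powers of $\tilde{A}$, with product topology and pointwise structure. Morphisms in $\mathcal{X}$ are the continuous maps preserving all operations in $F$, partial operations in $H$ (including their domains) and relations in $R$. For $\mathbf{B}\in\mathcal{A}$, let $D(\mathbf{B})=\mathcal{A}(\mathbf{B},\mathbf{A})$ be the set of all homomorphisms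 $\mathbf{B}\to\mathbf{A}$, viewed as a closed substructure of $\tilde{A}^{B}$. For $\tilde{X}\in\mathcal{X}$, let $E(\tilde{X})=\mathcal{X}(\tilde{X},\tilde{A})$ be the set of all morphisms $\tilde{X}\to\tilde{A}$, viewed as a subalgebra of $\mathbf{A}^{X}$. The natural embedding $e_{\mathbf{B}}:\mathbf{B}\to ED(\mathbf{B})$ is given by evaluation: $e_{\mathbf{B}}(b)(x)=x(b)$ for $b\in B$, $x\in D(\mathbf{B})$. The structure $\tilde{A}$ yields a (natural) duality on $\mathcal{A}$ if $e_{\mathbf{B}}$ is an isomorphism for every $\mathbf{B}\in\mathcal{A}$. The algebra $\mathbf{A}$ admits a natural duality (is dualizable) if there is some choice of $F,H,R$ satisfying (a), (b), (c) such that $\tilde{A}$ yields a duality on $\mathcal{A}$. Homomorphisms and subalgebras are taken with respect to the signature of $\mathbf{A}$, here $\{+,\cdot,0\}$. *)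

theory Defs
  imports "HOL-Analysis.Function_Topology"
begin

text \<open>Throughout, an \<open>n\<close>-tuple over \<open>S\<close> is an element of \<open>{..<n} \<rightarrow>\<^sub>E S\<close>. Functions between
  carriers are extensional, so that they are determined by their graphs.\<close>

definition map_tuple :: "nat \<Rightarrow> ('a \<Rightarrow> 'b) \<Rightarrow> (nat \<Rightarrow> 'a) \<Rightarrow> (nat \<Rightarrow> 'b)" where
  "map_tuple n g v = (\<lambda>k\<in>{..<n}. g (v k))"

section \<open>Algebras\<close>

record ('s, 'a) algebra =
  univ :: "'a set"
  arity :: "'s \<Rightarrow> nat"
  oper :: "'s \<Rightarrow> (nat \<Rightarrow> 'a) \<Rightarrow> 'a"

definition is_algebra :: "('s, 'a) algebra \<Rightarrow> bool" where
  "is_algebra A \<longleftrightarrow>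
     (\<forall>s. \<forall>v \<in> {..<arity A s} \<rightarrow>\<^sub>E univ A. oper A s v \<in> univ A)"

definition subuniverse :: "'a set \<Rightarrow> ('s, 'a) algebra \<Rightarrow> bool" where
  "subuniverse S A \<longleftrightarrow>
     S \<subseteq> univ A \<and> (\<forall>s. \<forall>v \<in> {..<arity A s} \<rightarrow>\<^sub>E S. oper A s v \<in> S)"

definition subalg :: "('s, 'a) algebra \<Rightarrow> 'a set \<Rightarrow> ('s, 'a) algebra" where
  "subalg A S = A\<lparr>univ := S\<rparr>"

definition direct_power :: "('s, 'a) algebra \<Rightarrow> 'i set \<Rightarrow> ('s, 'i \<Rightarrow> 'a) algebra" where
  "direct_power A I =
     \<lparr>univ = I \<rightarrow>\<^sub>E univ A,
      arity = arity A,
      oper = (\<lambda>s v. \<lambda>i\<in>I. oper A s (map_tuple (arity A s) (\<lambda>a. a i) v))\<rparr>"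

definition alg_hom :: "('s, 'a) algebra \<Rightarrow> ('s, 'b) algebra \<Rightarrow> ('a \<Rightarrow> 'b) set" where
  "alg_hom A B =
     {g \<in> univ A \<rightarrow>\<^sub>E univ B.
        arity A = arity B \<and>
        (\<forall>s. \<forall>v \<in> {..<arity A s} \<rightarrow>\<^sub>E univ A.
           g (oper A s v) = oper B s (map_tuple (arity A s) g v))}"

definition alg_iso :: "('s, 'a) algebra \<Rightarrow> ('s, 'b) algebra \<Rightarrow> ('a \<Rightarrow> 'b) set" where
  "alg_iso A B = {g \<in> alg_hom A B. bij_betw g (univ A) (univ B)}"

text \<open>The index sets of the powers range over subsets of the type \<open>'b \<Rightarrow> 'a\<close>. This loses nothing:
  an algebra \<open>B\<close> that embeds into some power of \<open>A\<close> embeds into the power of \<open>A\<close> indexed by the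
  set \<open>alg_hom B A\<close>.\<close>

definition ISP :: "('s, 'a) algebra \<Rightarrow> ('s, 'b) algebra set" where
  "ISP A =
     {B. is_algebra B \<and>
         (\<exists>(I :: ('b \<Rightarrow> 'a) set) S.
            subuniverse S (direct_power A I) \<and> alg_iso B (subalg (direct_power A I) S) \<noteq> {})}"

section \<open>Topological structures\<close>

text \<open>A topological space (with carrier \<open>topspace (tspace X)\<close>) with total operations, partial
  operations and relations, indexed by sets of symbols.\<close>

record ('f, 'h, 'r, 'x) tstruct =
  tspace :: "'x topology"
  fsyms :: "'f set"
  farity :: "'f \<Rightarrow> nat"
  fint :: "'f \<Rightarrow> (nat \<Rightarrow> 'x) \<Rightarrow> 'x"
  hsyms :: "'h set"
  harity :: "'h \<Rightarrow> nat"
  hdom :: "'h \<Rightarrow> (nat \<Rightarrow> 'x) set"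
  hint :: "'h \<Rightarrow> (nat \<Rightarrow> 'x) \<Rightarrow> 'x"
  rsyms :: "'r set"
  rarity :: "'r \<Rightarrow> nat"
  rint :: "'r \<Rightarrow> (nat \<Rightarrow> 'x) set"

definition tpower :: "('f, 'h, 'r, 'x) tstruct \<Rightarrow> 'i set \<Rightarrow> ('f, 'h, 'r, 'i \<Rightarrow> 'x) tstruct" where
  "tpower M I =
     \<lparr>tspace = product_topology (\<lambda>_. tspace M) I,
      fsyms = fsyms M,
      farity = farity M,
      fint = (\<lambda>f v. \<lambda>i\<in>I. fint M f (map_tuple (farity M f) (\<lambda>a. a i) v)),
      hsyms = hsyms M,
      harity = harity M,
      hdom = (\<lambda>h. {v \<in> {..<harity M h} \<rightarrow>\<^sub>E (I \<rightarrow>\<^sub>E topspace (tspace M)).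
                     \<forall>i\<in>I. map_tuple (harity M h) (\<lambda>a. a i) v \<in> hdom M h}),
      hint = (\<lambda>h v. \<lambda>i\<in>I. hint M h (map_tuple (harity M h) (\<lambda>a. a i) v)),
      rsyms = rsyms M,
      rarity = rarity M,
      rint = (\<lambda>r. {v \<in> {..<rarity M r} \<rightarrow>\<^sub>E (I \<rightarrow>\<^sub>E topspace (tspace M)).
                     \<forall>i\<in>I. map_tuple (rarity M r) (\<lambda>a. a i) v \<in> rint M r})\<rparr>"

definition tsub :: "('f, 'h, 'r, 'x) tstruct \<Rightarrow> 'x set \<Rightarrow> ('f, 'h, 'r, 'x) tstruct" where
  "tsub M Y =
     M\<lparr>tspace := subtopology (tspace M) Y,
       hdom := (\<lambda>h. hdom M h \<inter> ({..<harity M h} \<rightarrow>\<^sub>E Y)),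
       rint := (\<lambda>r. rint M r \<inter> ({..<rarity M r} \<rightarrow>\<^sub>E Y))\<rparr>"

definition tmor :: "('f, 'h, 'r, 'x) tstruct \<Rightarrow> ('f, 'h, 'r, 'y) tstruct \<Rightarrow> ('x \<Rightarrow> 'y) set" where
  "tmor X Y =
     {\<phi> \<in> topspace (tspace X) \<rightarrow>\<^sub>E topspace (tspace Y).
        continuous_map (tspace X) (tspace Y) \<phi> \<and>
        (\<forall>f \<in> fsyms X. \<forall>v \<in> {..<farity X f} \<rightarrow>\<^sub>E topspace (tspace X).
           \<phi> (fint X f v) = fint Y f (map_tuple (farity X f) \<phi> v)) \<and>
        (\<forall>h \<in> hsyms X. \<forall>v \<in> hdom X h.
           map_tuple (harity X h) \<phi> v \<in> hdom Y h \<and>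
           \<phi> (hint X h v) = hint Y h (map_tuple (harity X h) \<phi> v)) \<and>
        (\<forall>r \<in> rsyms X. \<forall>v \<in> rint X r. map_tuple (rarity X r) \<phi> v \<in> rint Y r)}"

section \<open>Alter egos and natural dualities\<close>

text \<open>A finitary operation is a pair (arity, function), a partial operation a triple
  (arity, domain, function), a relation a pair (arity, set of tuples).\<close>

type_synonym 'a fin_op = "nat \<times> ((nat \<Rightarrow> 'a) \<Rightarrow> 'a)"
type_synonym 'a partial_op = "nat \<times> (nat \<Rightarrow> 'a) set \<times> ((nat \<Rightarrow> 'a) \<Rightarrow> 'a)"
type_synonym 'a fin_rel = "nat \<times> (nat \<Rightarrow> 'a) set"

definition algebraic_ops :: "('s, 'a) algebra \<Rightarrow> 'a fin_op set" where
  "algebraic_ops A = {(n, f). f \<in> alg_hom (direct_power A {..<n}) A}"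

definition algebraic_partial_ops :: "('s, 'a) algebra \<Rightarrow> 'a partial_op set" where
  "algebraic_partial_ops A =
     {(n, S, h). n \<ge> 1 \<and> subuniverse S (direct_power A {..<n}) \<and>
                 h \<in> alg_hom (subalg (direct_power A {..<n}) S) A}"

definition algebraic_rels :: "('s, 'a) algebra \<Rightarrow> 'a fin_rel set" where
  "algebraic_rels A = {(n, r). n \<ge> 1 \<and> subuniverse r (direct_power A {..<n})}"

text \<open>The structure on the carrier of \<open>A\<close> given by \<open>F\<close>, \<open>H\<close>, \<open>R\<close>; every operation, partial
  operation and relation serves as its own symbol.\<close>

definition alter_ego ::
  "('s, 'a) algebra \<Rightarrow> 'a fin_op set \<Rightarrow> 'a partial_op set \<Rightarrow> 'a fin_rel set \<Rightarrow>
   ('a fin_op, 'a partial_op, 'a fin_rel, 'a) tstruct" where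
  "alter_ego A F H R =
     \<lparr>tspace = discrete_topology (univ A),
      fsyms = F, farity = fst, fint = snd,
      hsyms = H, harity = fst, hdom = (\<lambda>h. fst (snd h)), hint = (\<lambda>h. snd (snd h)),
      rsyms = R, rarity = fst, rint = snd\<rparr>"

text \<open>For algebraic \<open>F\<close>, \<open>H\<close>, \<open>R\<close> the set \<open>alg_hom B A\<close> is closed in the power and closed under the
  pointwise (partial) operations. These are the only members of the dual class that the definition
  of a duality refers to.\<close>

definition dual_D ::
  "('s, 'a) algebra \<Rightarrow> ('f, 'h, 'r, 'a) tstruct \<Rightarrow> ('s, 'b) algebra \<Rightarrow>
   ('f, 'h, 'r, 'b \<Rightarrow> 'a) tstruct" where
  "dual_D A M B = tsub (tpower M (univ B)) (alg_hom B A)"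

definition dual_E ::
  "('s, 'a) algebra \<Rightarrow> ('f, 'h, 'r, 'a) tstruct \<Rightarrow> ('f, 'h, 'r, 'x) tstruct \<Rightarrow>
   ('s, 'x \<Rightarrow> 'a) algebra" where
  "dual_E A M X = subalg (direct_power A (topspace (tspace X))) (tmor X M)"

definition evaluation :: "('s, 'a) algebra \<Rightarrow> ('s, 'b) algebra \<Rightarrow> 'b \<Rightarrow> ('b \<Rightarrow> 'a) \<Rightarrow> 'a" where
  "evaluation A B = (\<lambda>b\<in>univ B. \<lambda>x\<in>alg_hom B A. x b)"

text \<open>HOL cannot quantify over types inside a formula, so the algebras \<open>B\<close> range over those whose
  carrier is a set of elements of a given type \<open>'b\<close>, passed as an argument. For a finite algebra
  \<open>A\<close> with countably many operation symbols all infinite types \<open>'b\<close> give the same notion: by a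
  compactness argument, if the evaluation map fails to be an isomorphism for some \<open>B\<close>, then it
  already fails for some countable \<open>B\<close>. Finite types would only see the finite members of
  \<open>ISP A\<close>.\<close>

definition yields_duality ::
  "'b itself \<Rightarrow> ('s, 'a) algebra \<Rightarrow> ('f, 'h, 'r, 'a) tstruct \<Rightarrow> bool" where
  "yields_duality _ A M \<longleftrightarrow>
     (\<forall>B :: ('s, 'b) algebra. B \<in> ISP A \<longrightarrow>
        evaluation A B \<in> alg_iso B (dual_E A M (dual_D A M B)))"

definition dualizable :: "'b itself \<Rightarrow> ('s, 'a) algebra \<Rightarrow> bool" where
  "dualizable T A \<longleftrightarrow>
     (\<exists>F H R. F \<subseteq> algebraic_ops A \<and> H \<subseteq> algebraic_partial_ops A \<and> R \<subseteq> algebraic_rels A \<and>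
        yields_duality T A (alter_ego A F H R))"

section \<open>The ring of even integers modulo 8\<close>

datatype ring_sym = Plus | Times | Zero

definition integers_mod :: "int \<Rightarrow> (ring_sym, int) algebra" where
  "integers_mod m =
     \<lparr>univ = {0..<m},
      arity = (\<lambda>s. case s of Plus \<Rightarrow> 2 | Times \<Rightarrow> 2 | Zero \<Rightarrow> 0),
      oper = (\<lambda>s v. case s of
                 Plus \<Rightarrow> (v 0 + v 1) mod m
               | Times \<Rightarrow> (v 0 * v 1) mod m
               | Zero \<Rightarrow> 0)\<rparr>"

definition two_Z8 :: "(ring_sym, int) algebra" where
  "two_Z8 = subalg (integers_mod 8) {0, 2, 4, 6}"

end

theory Submission
  imports Defs "HOL-Analysis.Product_Topology"
begin

text \<open>A ghost element argument. Suppose that \<open>B\<close> in \<open>ISP A\<close> contains a sequence \<open>c\<close> on which every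
  homomorphism \<open>x\<close> into \<open>A\<close> is constant up to one exceptional index. Sending \<open>x\<close> to its generic
  value on \<open>c\<close> agrees on every finite set of homomorphisms with the evaluation at some \<open>c i\<close>, hence
  preserves all algebraic structure, and it is continuous because the majority among \<open>x (c 0)\<close>,
  \<open>x (c 1)\<close>, \<open>x (c 2)\<close> determines it. If it is not an evaluation, then there is no duality.

  For \<open>2Z\<^sub>8\<close> take the levels \<open>False\<close>, \<open>True\<close> over \<open>nat\<close> as index set, let \<open>w\<^sub>i\<close> be \<open>2\<close> at the
  points over \<open>0\<close> and \<open>i + 1\<close>, and let \<open>u\<close> be \<open>2\<close> on the upper level. For distinct \<open>i, j, k, l\<close> we
  have \<open>(w\<^sub>i + w\<^sub>k) (w\<^sub>j + w\<^sub>l) = 0\<close>, so the values of a homomorphism at all but one \<open>w\<^sub>i\<close> agree modulo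
  \<open>4\<close>, and therefore its values at all but one \<open>c\<^sub>i = u w\<^sub>i\<close> agree. The pointwise limit of \<open>c\<close> is \<open>4\<close>
  at \<open>(True, 0)\<close> and \<open>0\<close> elsewhere; a parity condition on the total upper defect keeps it out of a
  subring that contains \<open>u\<close> and all \<open>w\<^sub>i\<close>.\<close>

section \<open>Homomorphisms\<close>

lemma map_tuple_apply [simp]: "k < n \<Longrightarrow> map_tuple n g v k = g (v k)"
  by (simp add: map_tuple_def)

lemma map_tuple_cong:
  "(\<And>k. k < n \<Longrightarrow> g (v k) = h (w k)) \<Longrightarrow> map_tuple n g v = map_tuple n h w"
  by (auto simp: map_tuple_def)

lemma map_tuple_in_PiE:
  assumes "\<And>k. k < n \<Longrightarrow> g (v k) \<in> S"
  shows "map_tuple n g v \<in> {..<n} \<rightarrow>\<^sub>E S"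
  using assms by (auto simp: map_tuple_def)

lemma map_tuple_map_tuple: "map_tuple n h (map_tuple n g v) = map_tuple n (h \<circ> g) v"
  by (auto simp: map_tuple_def)

lemma map_tuple_ident: "v \<in> {..<n} \<rightarrow>\<^sub>E S \<Longrightarrow> map_tuple n (\<lambda>a. a) v = v"
  by (auto simp: map_tuple_def PiE_def extensional_def fun_eq_iff)

lemma alg_homI:
  assumes "g \<in> univ A \<rightarrow>\<^sub>E univ B" "arity A = arity B"
    and "\<And>s v. v \<in> {..<arity A s} \<rightarrow>\<^sub>E univ A \<Longrightarrow>
      g (oper A s v) = oper B s (map_tuple (arity A s) g v)"
  shows "g \<in> alg_hom A B"
  using assms by (auto simp: alg_hom_def)

lemma alg_hom_oper:
  assumes "g \<in> alg_hom A B" "v \<in> {..<arity A s} \<rightarrow>\<^sub>E univ A"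
  shows "g (oper A s v) = oper B s (map_tuple (arity A s) g v)"
  using assms by (auto simp: alg_hom_def)

lemma alg_hom_in: "g \<in> alg_hom A B \<Longrightarrow> b \<in> univ A \<Longrightarrow> g b \<in> univ B"
  by (auto simp: alg_hom_def)

lemma alg_hom_compose:
  assumes g: "g \<in> alg_hom A B" and h: "h \<in> alg_hom B C" and A: "is_algebra A"
  shows "(\<lambda>a\<in>univ A. h (g a)) \<in> alg_hom A C"
proof (rule alg_homI)
  show "(\<lambda>a\<in>univ A. h (g a)) \<in> univ A \<rightarrow>\<^sub>E univ C"
    using alg_hom_in[OF g] alg_hom_in[OF h] by auto
  show "arity A = arity C" using g h by (simp add: alg_hom_def)
next
  fix s v assume v: "v \<in> {..<arity A s} \<rightarrow>\<^sub>E univ A"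
  have ar: "arity B = arity A" using g by (simp add: alg_hom_def)
  have gv: "map_tuple (arity A s) g v \<in> {..<arity B s} \<rightarrow>\<^sub>E univ B"
    unfolding ar using v alg_hom_in[OF g] by (intro map_tuple_in_PiE) auto
  have "oper A s v \<in> univ A" using A v by (auto simp: is_algebra_def)
  hence "(\<lambda>a\<in>univ A. h (g a)) (oper A s v) = h (oper B s (map_tuple (arity A s) g v))"
    using alg_hom_oper[OF g v] by simp
  also have "\<dots> = oper C s (map_tuple (arity A s) (h \<circ> g) v)"
    using alg_hom_oper[OF h gv] by (simp add: ar map_tuple_map_tuple)
  also have "map_tuple (arity A s) (h \<circ> g) v = map_tuple (arity A s) (\<lambda>a\<in>univ A. h (g a)) v"
    using v by (intro map_tuple_cong) auto
  finally show "(\<lambda>a\<in>univ A. h (g a)) (oper A s v) =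
    oper C s (map_tuple (arity A s) (\<lambda>a\<in>univ A. h (g a)) v)" .
qed

lemma is_algebra_subalg_direct_power:
  assumes "subuniverse S (direct_power A I)"
  shows "is_algebra (subalg (direct_power A I) S)"
  using assms by (auto simp: is_algebra_def subuniverse_def subalg_def)

lemma projection_alg_hom:
  assumes S: "subuniverse S (direct_power A I)" and i: "i \<in> I"
  shows "(\<lambda>f\<in>S. f i) \<in> alg_hom (subalg (direct_power A I) S) A"
proof (rule alg_homI)
  show "(\<lambda>f\<in>S. f i) \<in> univ (subalg (direct_power A I) S) \<rightarrow>\<^sub>E univ A"
    using S i by (auto simp: subuniverse_def subalg_def direct_power_def)
  show "arity (subalg (direct_power A I) S) = arity A"
    by (simp add: subalg_def direct_power_def)
next
  fix s v assume "v \<in> {..<arity (subalg (direct_power A I) S) s} \<rightarrow>\<^sub>E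
    univ (subalg (direct_power A I) S)"
  hence v: "v \<in> {..<arity A s} \<rightarrow>\<^sub>E S" by (simp add: subalg_def direct_power_def)
  hence "oper (direct_power A I) s v \<in> S"
    using S by (simp add: subuniverse_def direct_power_def)
  moreover have "map_tuple (arity A s) (\<lambda>a. a i) v = map_tuple (arity A s) (\<lambda>f\<in>S. f i) v"
    using v by (intro map_tuple_cong) auto
  ultimately show "(\<lambda>f\<in>S. f i) (oper (subalg (direct_power A I) S) s v) =
      oper A s (map_tuple (arity (subalg (direct_power A I) S) s) (\<lambda>f\<in>S. f i) v)"
    using i by (simp add: subalg_def direct_power_def)
qed

lemma evaluation_alg_hom:
  assumes B: "is_algebra B" and ar: "arity B = arity A"
  shows "evaluation A B \<in> alg_hom B (direct_power A (alg_hom B A))"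
proof (rule alg_homI)
  show "evaluation A B \<in> univ B \<rightarrow>\<^sub>E univ (direct_power A (alg_hom B A))"
    by (auto simp: evaluation_def direct_power_def alg_hom_in)
  show "arity B = arity (direct_power A (alg_hom B A))"
    by (simp add: ar direct_power_def)
next
  fix s v assume v: "v \<in> {..<arity B s} \<rightarrow>\<^sub>E univ B"
  have "oper B s v \<in> univ B" using B v by (auto simp: is_algebra_def)
  moreover have "map_tuple (arity A s) (\<lambda>a. a x) (map_tuple (arity A s) (evaluation A B) v)
      = map_tuple (arity A s) x v" if "x \<in> alg_hom B A" for x
    unfolding map_tuple_map_tuple using v that
    by (intro map_tuple_cong) (auto simp: evaluation_def ar)
  ultimately show "evaluation A B (oper B s v) =
      oper (direct_power A (alg_hom B A)) s (map_tuple (arity B s) (evaluation A B) v)"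
    using v by (auto simp: evaluation_def direct_power_def ar alg_hom_oper intro!: restrict_ext)
qed

lemma image_subuniverse:
  assumes g: "g \<in> alg_hom B C" and B: "is_algebra B"
  shows "subuniverse (g ` univ B) C"
  unfolding subuniverse_def
proof (intro conjI allI ballI)
  show "g ` univ B \<subseteq> univ C" using alg_hom_in[OF g] by auto
  fix s v assume v: "v \<in> {..<arity C s} \<rightarrow>\<^sub>E g ` univ B"
  have ar: "arity C = arity B" using g by (simp add: alg_hom_def)
  define w where "w = map_tuple (arity B s) (inv_into (univ B) g) v"
  have w: "w \<in> {..<arity B s} \<rightarrow>\<^sub>E univ B"
    unfolding w_def
    by (intro map_tuple_in_PiE inv_into_into) (rule PiE_mem[OF v], simp add: ar)
  have "map_tuple (arity B s) g w = map_tuple (arity B s) (\<lambda>a. a) v"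
    unfolding w_def map_tuple_map_tuple o_def
    by (intro map_tuple_cong f_inv_into_f) (rule PiE_mem[OF v], simp add: ar)
  also have "\<dots> = v" using v map_tuple_ident by (metis ar)
  finally have "oper C s v = g (oper B s w)"
    using alg_hom_oper[OF g w] by simp
  thus "oper C s v \<in> g ` univ B" using B w by (auto simp: is_algebra_def)
qed

text \<open>Separation of points makes the evaluation map injective, so it embeds \<open>B\<close>
  into the power indexed by \<open>alg_hom B A\<close>, an index set of the type that
  \<open>ISP\<close> asks for.\<close>

lemma ISP_if_separated:
  assumes B: "is_algebra B" and ar: "arity B = arity A"
    and sep: "\<And>a b. \<lbrakk>a \<in> univ B; b \<in> univ B; a \<noteq> b\<rbrakk> \<Longrightarrow> \<exists>x\<in>alg_hom B A. x a \<noteq> x b"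
  shows "B \<in> ISP A"
proof -
  let ?e = "evaluation A B" and ?P = "direct_power A (alg_hom B A)"
  have e: "?e \<in> alg_hom B ?P" by (rule evaluation_alg_hom[OF B ar])
  have "inj_on ?e (univ B)"
  proof (rule inj_onI, rule ccontr)
    fix a b assume ab: "a \<in> univ B" "b \<in> univ B" "?e a = ?e b" "a \<noteq> b"
    then obtain x where "x \<in> alg_hom B A" "x a \<noteq> x b" using sep by blast
    thus False using ab by (auto simp: evaluation_def restrict_def fun_eq_iff split: if_splits)
  qed
  moreover have "?e \<in> alg_hom B (subalg ?P (?e ` univ B))"
    using e by (auto simp: alg_hom_def subalg_def)
  ultimately have "?e \<in> alg_iso B (subalg ?P (?e ` univ B))"
    by (auto simp: alg_iso_def bij_betw_def subalg_def)
  thus ?thesis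
    using B image_subuniverse[OF e B] unfolding ISP_def by blast
qed

lemma ISP_is_algebra: "B \<in> ISP A \<Longrightarrow> is_algebra B"
  by (auto simp: ISP_def)

lemma ISP_arity: "B \<in> ISP A \<Longrightarrow> arity B = arity A"
  by (auto simp: ISP_def alg_iso_def alg_hom_def subalg_def direct_power_def)

text \<open>Since \<open>h\<close> commutes with the operations of \<open>A\<close>, applying it
  pointwise to homomorphisms gives a homomorphism. The value is thus again a point of the dual,
  where local agreement with an evaluation can be invoked.\<close>

lemma pointwise_op_alg_hom:
  assumes B: "is_algebra B" and ar: "arity B = arity A"
    and h: "h \<in> alg_hom (subalg (direct_power A {..<n}) S) A"
    and v: "v \<in> {..<n} \<rightarrow>\<^sub>E alg_hom B A"
    and dom: "\<And>b. b \<in> univ B \<Longrightarrow> map_tuple n (\<lambda>x. x b) v \<in> S"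
  shows "(\<lambda>b\<in>univ B. h (map_tuple n (\<lambda>x. x b) v)) \<in> alg_hom B A" (is "?y \<in> _")
proof (rule alg_homI)
  have hS: "h a \<in> univ A" if "a \<in> S" for a
    using alg_hom_in[OF h] that by (simp add: subalg_def)
  show "?y \<in> univ B \<rightarrow>\<^sub>E univ A" using hS dom by auto
  show "arity B = arity A" by (rule ar)
next
  fix s w assume w: "w \<in> {..<arity B s} \<rightarrow>\<^sub>E univ B"
  let ?m = "arity A s"
  let ?W = "map_tuple ?m (\<lambda>b. map_tuple n (\<lambda>x. x b) v) w"
  have wB: "w k \<in> univ B" if "k < ?m" for k using w that by (auto simp: ar)
  have W: "?W \<in> {..<arity (subalg (direct_power A {..<n}) S) s} \<rightarrow>\<^sub>E
      univ (subalg (direct_power A {..<n}) S)"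
    using map_tuple_in_PiE[of ?m "\<lambda>b. map_tuple n (\<lambda>x. x b) v" w S] dom wB
    by (simp add: subalg_def direct_power_def)
  have "map_tuple n (\<lambda>x. x (oper B s w)) v = oper (direct_power A {..<n}) s ?W"
  proof
    fix k
    show "map_tuple n (\<lambda>x. x (oper B s w)) v k = oper (direct_power A {..<n}) s ?W k"
    proof (cases "k < n")
      case True
      hence "v k \<in> alg_hom B A" using v by auto
      from alg_hom_oper[OF this w]
      have "v k (oper B s w) = oper A s (map_tuple ?m (v k) w)" by (simp add: ar)
      also have "map_tuple ?m (v k) w = map_tuple ?m (\<lambda>a. a k) ?W"
        using True by (intro map_tuple_cong) auto
      finally show ?thesis using True by (simp add: direct_power_def)
    qed (simp add: map_tuple_def direct_power_def)
  qed
  hence "h (map_tuple n (\<lambda>x. x (oper B s w)) v) = oper A s (map_tuple ?m h ?W)"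
    using alg_hom_oper[OF h W] by (simp add: subalg_def direct_power_def)
  also have "map_tuple ?m h ?W = map_tuple ?m ?y w"
    by (intro map_tuple_cong) (simp add: wB)
  finally show "?y (oper B s w) = oper A s (map_tuple (arity B s) ?y w)"
    using B w by (simp add: is_algebra_def ar)
qed

section \<open>Ghost elements\<close>

text \<open>Three entries suffice if at most one index is exceptional: when
  \<open>u 0 = u 1\<close>, one of the two is generic; when they differ, the exception is
  \<open>0\<close> or \<open>1\<close>, so \<open>u 2\<close> is generic.\<close>

definition majority :: "(nat \<Rightarrow> 'a) \<Rightarrow> 'a" where
  "majority u = (if u 0 = u 1 then u 0 else u 2)"

lemma majority_eq:
  assumes "\<And>i j. i \<noteq> k \<Longrightarrow> j \<noteq> k \<Longrightarrow> u i = u j" and "i \<noteq> k"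
  shows "majority u = u i"
proof -
  have "\<exists>m. m \<noteq> k \<and> majority u = u m"
  proof (cases "k = 0 \<or> k = 1")
    case True
    thus ?thesis by (cases "u 0 = u 1") (auto simp: majority_def intro: exI[of _ 1] exI[of _ 0] exI[of _ 2])
  next
    case False
    hence "0 \<noteq> k" "1 \<noteq> k" by auto
    thus ?thesis using assms(1)[of 0 1] unfolding majority_def by metis
  qed
  thus ?thesis using assms by metis
qed

lemma topspace_dual_D:
  "topspace (tspace (dual_D A (alter_ego A F H R) B)) = alg_hom B A"
  by (auto simp: dual_D_def tsub_def tpower_def alter_ego_def alg_hom_def)

lemma majority_continuous:
  assumes c: "\<And>i. c i \<in> univ B"
  shows "continuous_map (tspace (dual_D A (alter_ego A F H R) B)) (discrete_topology (univ A))
    (\<lambda>x\<in>alg_hom B A. majority (\<lambda>i. x (c i)))"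
proof -
  let ?X = "tspace (dual_D A (alter_ego A F H R) B)" and ?U = "discrete_topology (univ A)"
  have X: "?X = subtopology (product_topology (\<lambda>_. ?U) (univ B)) (alg_hom B A)"
    by (simp add: dual_D_def tsub_def tpower_def alter_ego_def)
  have p: "continuous_map ?X ?U (\<lambda>x. x b)" if "b \<in> univ B" for b
    unfolding X by (intro continuous_map_from_subtopology continuous_map_product_projection that)
  \<comment> \<open>A finite product of discrete spaces is discrete, so every function of these
    three coordinates is continuous.\<close>
  have t: "continuous_map ?X (discrete_topology (univ A \<times> univ A \<times> univ A))
      (\<lambda>x. (x (c 0), x (c 1), x (c 2)))"
    unfolding prod_topology_discrete_topology
    by (intro continuous_map_pairedI p c)
  have m: "continuous_map (discrete_topology (univ A \<times> univ A \<times> univ A)) ?U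
      (\<lambda>(a, b, d). if a = b then a else d)"
    by (auto simp: continuous_map_def)
  have "continuous_map ?X ?U (\<lambda>x. majority (\<lambda>i. x (c i)))"
    using continuous_map_compose[OF t m] by (simp add: o_def majority_def)
  thus ?thesis
    by (rule continuous_map_eq) (simp add: topspace_dual_D)
qed

text \<open>Each preservation condition involves only finitely many points of the dual: the entries
  of one tuple and, for an operation, its value. On such a set \<open>\<gamma>\<close> is evaluation
  at a single element, and evaluations preserve algebraic structure.\<close>

lemma locally_evaluation_tmor:
  fixes B :: "('s, 'b) algebra"
  assumes B: "B \<in> ISP A"
    and FHR: "F \<subseteq> algebraic_ops A" "H \<subseteq> algebraic_partial_ops A" "R \<subseteq> algebraic_rels A"
    and ext: "\<gamma> \<in> extensional (alg_hom B A)"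
    and cont: "continuous_map (tspace (dual_D A (alter_ego A F H R) B))
      (discrete_topology (univ A)) \<gamma>"
    and loc: "\<And>Y. finite Y \<Longrightarrow> Y \<subseteq> alg_hom B A \<Longrightarrow> \<exists>b\<in>univ B. \<forall>x\<in>Y. \<gamma> x = x b"
  shows "\<gamma> \<in> tmor (dual_D A (alter_ego A F H R) B) (alter_ego A F H R)"
proof -
  let ?M = "alter_ego A F H R" and ?D = "alg_hom B A"
  let ?X = "dual_D A ?M B"
  have alg: "is_algebra B" and ar: "arity B = arity A"
    using B by (auto dest: ISP_is_algebra ISP_arity)
  have tupleloc: "\<exists>b\<in>univ B. map_tuple n \<gamma> v = map_tuple n (\<lambda>x. x b) v \<and> \<gamma> y = y b"
    if "v \<in> {..<n} \<rightarrow>\<^sub>E ?D" "y \<in> ?D" for n v y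
  proof -
    \<comment> \<open>The extra point \<open>y\<close> is there for the value of an operation, so
      that one \<open>b\<close> serves both the arguments and the value.\<close>
    have "\<exists>b\<in>univ B. \<forall>x\<in>insert y (v ` {..<n}). \<gamma> x = x b"
      using that by (intro loc) auto
    thus ?thesis by (fastforce intro: map_tuple_cong)
  qed
  have part: "map_tuple n \<gamma> v \<in> S \<and>
      \<gamma> (\<lambda>b\<in>univ B. h (map_tuple n (\<lambda>x. x b) v)) = h (map_tuple n \<gamma> v)"
    if h: "h \<in> alg_hom (subalg (direct_power A {..<n}) S) A"
      and v: "v \<in> {..<n} \<rightarrow>\<^sub>E ?D"
      and dom: "\<And>b. b \<in> univ B \<Longrightarrow> map_tuple n (\<lambda>x. x b) v \<in> S" for n S h v
    using tupleloc[OF v pointwise_op_alg_hom[OF alg ar h v dom]] dom by force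
  have fcl: "\<gamma> (fint ?X f v) = fint ?M f (map_tuple (farity ?X f) \<gamma> v)"
    if "f \<in> fsyms ?X" "v \<in> {..<farity ?X f} \<rightarrow>\<^sub>E topspace (tspace ?X)" for f v
  proof -
    obtain n h where f: "f = (n, h)" by (cases f)
    \<comment> \<open>A total operation is treated as a partial one whose domain is the whole
      power.\<close>
    have h: "h \<in> alg_hom (subalg (direct_power A {..<n}) ({..<n} \<rightarrow>\<^sub>E univ A)) A"
      using that(1) FHR(1)
      by (auto simp: f dual_D_def tsub_def tpower_def alter_ego_def algebraic_ops_def
        subalg_def direct_power_def)
    have v: "v \<in> {..<n} \<rightarrow>\<^sub>E ?D"
      using that(2) unfolding topspace_dual_D
      by (simp add: f dual_D_def tsub_def tpower_def alter_ego_def)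
    have "map_tuple n (\<lambda>x. x b) v \<in> {..<n} \<rightarrow>\<^sub>E univ A" if "b \<in> univ B" for b
      using v that by (intro map_tuple_in_PiE) (auto intro: alg_hom_in)
    from part[OF h v this] show ?thesis
      by (simp add: f dual_D_def tsub_def tpower_def alter_ego_def)
  qed
  have hcl: "map_tuple (harity ?X f) \<gamma> v \<in> hdom ?M f \<and>
      \<gamma> (hint ?X f v) = hint ?M f (map_tuple (harity ?X f) \<gamma> v)"
    if "f \<in> hsyms ?X" "v \<in> hdom ?X f" for f v
  proof -
    obtain n S h where f: "f = (n, S, h)" by (cases f)
    have h: "h \<in> alg_hom (subalg (direct_power A {..<n}) S) A"
      using that(1) FHR(2)
      by (auto simp: f dual_D_def tsub_def tpower_def alter_ego_def algebraic_partial_ops_def)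
    have v: "v \<in> {..<n} \<rightarrow>\<^sub>E ?D" "\<And>b. b \<in> univ B \<Longrightarrow> map_tuple n (\<lambda>x. x b) v \<in> S"
      using that(2) by (auto simp: f dual_D_def tsub_def tpower_def alter_ego_def)
    from part[OF h v] show ?thesis
      by (simp add: f dual_D_def tsub_def tpower_def alter_ego_def)
  qed
  have rcl: "map_tuple (rarity ?X r) \<gamma> v \<in> rint ?M r"
    if "r \<in> rsyms ?X" "v \<in> rint ?X r" for r v
  proof -
    obtain n S where r: "r = (n, S)" by (cases r)
    have v: "v \<in> {..<n} \<rightarrow>\<^sub>E ?D" "\<And>b. b \<in> univ B \<Longrightarrow> map_tuple n (\<lambda>x. x b) v \<in> S"
      using that(2) by (auto simp: r dual_D_def tsub_def tpower_def alter_ego_def)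
    have n: "n \<ge> 1"
      using that(1) FHR(3)
      by (auto simp: r dual_D_def tsub_def tpower_def alter_ego_def algebraic_rels_def)
    \<comment> \<open>Positive arity supplies an entry of \<open>v\<close> to fill the slot
      \<open>y\<close> of \<open>tupleloc\<close>.\<close>
    hence "v 0 \<in> ?D" by (intro PiE_mem[OF v(1)]) simp
    from tupleloc[OF v(1) this] v(2) show ?thesis
      by (auto simp: r dual_D_def tsub_def tpower_def alter_ego_def)
  qed
  have "\<gamma> \<in> topspace (tspace ?X) \<rightarrow>\<^sub>E topspace (tspace ?M)"
    using continuous_map_image_subset_topspace[OF cont] ext
    unfolding topspace_dual_D by (auto simp: topspace_dual_D[unfolded alter_ego_def]
      alter_ego_def PiE_def)
  thus ?thesis
    using cont fcl hcl rcl by (simp add: tmor_def alter_ego_def)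
qed

lemma not_dualizable_if_ghost:
  fixes A :: "('s, 'a) algebra" and B :: "('s, 'b) algebra"
  assumes B: "B \<in> ISP A"
    and c: "\<And>i. c i \<in> univ B"
    and almost: "\<And>x. x \<in> alg_hom B A \<Longrightarrow>
      \<exists>k::nat. \<forall>i j. i \<noteq> k \<longrightarrow> j \<noteq> k \<longrightarrow> x (c i) = x (c j)"
    and ghost: "\<And>b. b \<in> univ B \<Longrightarrow> \<exists>x\<in>alg_hom B A. infinite {i. x (c i) \<noteq> x b}"
  shows "\<not> dualizable TYPE('b) A"
proof
  assume "dualizable TYPE('b) A"
  then obtain F H R where FHR:
      "F \<subseteq> algebraic_ops A" "H \<subseteq> algebraic_partial_ops A" "R \<subseteq> algebraic_rels A"
    and dual: "yields_duality TYPE('b) A (alter_ego A F H R)"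
    unfolding dualizable_def by blast
  let ?M = "alter_ego A F H R"
  define \<gamma> where "\<gamma> = (\<lambda>x\<in>alg_hom B A. majority (\<lambda>i. x (c i)))"
  have "\<forall>x\<in>alg_hom B A. \<exists>k. \<forall>i. i \<noteq> k \<longrightarrow> \<gamma> x = x (c i)"
  proof
    fix x assume x: "x \<in> alg_hom B A"
    from almost[OF x] obtain k where k: "\<forall>i j. i \<noteq> k \<longrightarrow> j \<noteq> k \<longrightarrow> x (c i) = x (c j)" by blast
    have "majority (\<lambda>i. x (c i)) = x (c i)" if "i \<noteq> k" for i
      using majority_eq[where u = "\<lambda>i. x (c i)" and k = k and i = i] k that by blast
    thus "\<exists>k. \<forall>i. i \<noteq> k \<longrightarrow> \<gamma> x = x (c i)" using x by (auto simp: \<gamma>_def)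
  qed
  \<comment> \<open>\<open>\<kappa> x\<close> is the exceptional index of \<open>x\<close>. A finite
    set of homomorphisms has finitely many of them, and any other index gives the evaluation that
    agrees with \<open>\<gamma>\<close> on the set.\<close>
  then obtain \<kappa> where \<kappa>: "\<And>x i. x \<in> alg_hom B A \<Longrightarrow> i \<noteq> \<kappa> x \<Longrightarrow> \<gamma> x = x (c i)"
    by metis
  have "\<gamma> \<in> tmor (dual_D A ?M B) ?M"
  proof (rule locally_evaluation_tmor[OF B FHR])
    show "\<gamma> \<in> extensional (alg_hom B A)" by (simp add: \<gamma>_def)
    show "continuous_map (tspace (dual_D A ?M B)) (discrete_topology (univ A)) \<gamma>"
      unfolding \<gamma>_def by (rule majority_continuous[OF c])
    fix Y :: "('b \<Rightarrow> 'a) set" assume Y: "finite Y" "Y \<subseteq> alg_hom B A"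
    obtain i where "i \<notin> \<kappa> ` Y"
      using ex_new_if_finite[of "\<kappa> ` Y"] Y(1) by auto
    hence "\<forall>x\<in>Y. \<gamma> x = x (c i)" using Y(2) \<kappa> by blast
    thus "\<exists>b\<in>univ B. \<forall>x\<in>Y. \<gamma> x = x b" using c by blast
  qed
  moreover have "evaluation A B ` univ B = tmor (dual_D A ?M B) ?M"
    using dual B by (auto simp: yields_duality_def alg_iso_def bij_betw_def dual_E_def subalg_def)
  ultimately obtain b where b: "b \<in> univ B" "\<gamma> = evaluation A B b" by blast
  from ghost[OF b(1)] obtain x where x: "x \<in> alg_hom B A" "infinite {i. x (c i) \<noteq> x b}" by blast
  have "\<gamma> x = x b" using b x by (simp add: evaluation_def)
  \<comment> \<open>If \<open>\<gamma>\<close> is evaluation at \<open>b\<close>, then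
    \<open>x (c i)\<close> can differ from \<open>x b\<close> only at the index
    \<open>\<kappa> x\<close>, whereas \<open>ghost\<close> provides infinitely many
    differences.\<close>
  hence "{i. x (c i) \<noteq> x b} \<subseteq> {\<kappa> x}" using \<kappa>[OF x(1)] by force
  thus False using x(2) finite_subset by blast
qed

section \<open>Transport of structure to a carrier in a prescribed type\<close>

definition alg_copy :: "('a \<Rightarrow> 'b) \<Rightarrow> ('s, 'a) algebra \<Rightarrow> ('s, 'b) algebra" where
  "alg_copy t B = \<lparr>univ = t ` univ B, arity = arity B,
     oper = (\<lambda>s v. t (oper B s (map_tuple (arity B s) (inv_into (univ B) t) v)))\<rparr>"

lemma alg_copy:
  assumes inj: "inj_on t (univ B)" and B: "is_algebra B"
  shows is_algebra_alg_copy: "is_algebra (alg_copy t B)"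
    and alg_copy_hom: "restrict t (univ B) \<in> alg_hom B (alg_copy t B)"
    and alg_copy_inv_hom: "restrict (inv_into (univ B) t) (t ` univ B) \<in> alg_hom (alg_copy t B) B"
proof -
  let ?i = "inv_into (univ B) t"
  have i: "map_tuple n ?i v \<in> {..<n} \<rightarrow>\<^sub>E univ B" if "v \<in> {..<n} \<rightarrow>\<^sub>E t ` univ B" for n v
    by (intro map_tuple_in_PiE inv_into_into) (rule PiE_mem[OF that], simp)
  have op: "oper B s v \<in> univ B" if "v \<in> {..<arity B s} \<rightarrow>\<^sub>E univ B" for s v
    using B that by (auto simp: is_algebra_def)
  show "is_algebra (alg_copy t B)"
    unfolding is_algebra_def
  proof (intro allI ballI)
    fix s v assume "v \<in> {..<arity (alg_copy t B) s} \<rightarrow>\<^sub>E univ (alg_copy t B)"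
    hence "v \<in> {..<arity B s} \<rightarrow>\<^sub>E t ` univ B" by (simp add: alg_copy_def)
    from op[OF i[OF this]] show "oper (alg_copy t B) s v \<in> univ (alg_copy t B)"
      by (simp add: alg_copy_def)
  qed
  show "restrict t (univ B) \<in> alg_hom B (alg_copy t B)"
  proof (rule alg_homI)
    fix s v assume v: "v \<in> {..<arity B s} \<rightarrow>\<^sub>E univ B"
    have "map_tuple (arity B s) ?i (map_tuple (arity B s) (restrict t (univ B)) v)
        = map_tuple (arity B s) (\<lambda>a. a) v"
      unfolding map_tuple_map_tuple
    proof (rule map_tuple_cong)
      fix k assume "k < arity B s"
      hence "v k \<in> univ B" by (intro PiE_mem[OF v]) simp
      thus "(?i \<circ> restrict t (univ B)) (v k) = v k" using inj by simp
    qed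
    also have "\<dots> = v" using v by (rule map_tuple_ident)
    finally show "restrict t (univ B) (oper B s v) =
        oper (alg_copy t B) s (map_tuple (arity B s) (restrict t (univ B)) v)"
      using op[OF v] by (simp add: alg_copy_def)
  qed (auto simp: alg_copy_def)
  show "restrict ?i (t ` univ B) \<in> alg_hom (alg_copy t B) B"
  proof (rule alg_homI)
    fix s v assume "v \<in> {..<arity (alg_copy t B) s} \<rightarrow>\<^sub>E univ (alg_copy t B)"
    hence v: "v \<in> {..<arity B s} \<rightarrow>\<^sub>E t ` univ B" by (simp add: alg_copy_def)
    have "map_tuple (arity B s) (restrict ?i (t ` univ B)) v = map_tuple (arity B s) ?i v"
    proof (rule map_tuple_cong)
      fix k assume "k < arity B s"
      hence "v k \<in> t ` univ B" by (intro PiE_mem[OF v]) simp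
      thus "restrict ?i (t ` univ B) (v k) = ?i (v k)" by simp
    qed
    thus "restrict ?i (t ` univ B) (oper (alg_copy t B) s v) =
        oper B s (map_tuple (arity (alg_copy t B) s) (restrict ?i (t ` univ B)) v)"
      using op[OF i[OF v]] inj by (simp add: alg_copy_def)
  qed (auto simp: alg_copy_def intro: inv_into_into)
qed

text \<open>A countable subalgebra of a power has a copy inside any infinite type. Homomorphisms of
  the copy pull back along \<open>t\<close> to homomorphisms on \<open>S\<close>, and coordinate
  projections become homomorphisms of the copy. Projections separate points and turn the
  coordinatewise \<open>ghost\<close> condition into the one on homomorphisms.\<close>

lemma not_dualizable_if_ghost_in_power:
  fixes A :: "('s, 'a) algebra" and S :: "('i \<Rightarrow> 'a) set"
  assumes inf: "infinite (UNIV :: 'b set)" and cnt: "countable S"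
    and S: "subuniverse S (direct_power A I)"
    and c: "\<And>i. c i \<in> S"
    and almost: "\<And>x. x \<in> alg_hom (subalg (direct_power A I) S) A \<Longrightarrow>
      \<exists>k::nat. \<forall>i j. i \<noteq> k \<longrightarrow> j \<noteq> k \<longrightarrow> x (c i) = x (c j)"
    and ghost: "\<And>b. b \<in> S \<Longrightarrow> \<exists>p\<in>I. infinite {i. c i p \<noteq> b p}"
  shows "\<not> dualizable TYPE('b) A"
proof -
  let ?B = "subalg (direct_power A I) S"
  have univ: "univ ?B = S" by (simp add: subalg_def)
  have B: "is_algebra ?B" by (rule is_algebra_subalg_direct_power[OF S])
  obtain e :: "nat \<Rightarrow> 'b" where e: "inj e"
    using infinite_countable_subset[OF inf] by blast
  define t where "t = e \<circ> to_nat_on S"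
  have inj: "inj_on t S"
    unfolding t_def using e inj_on_to_nat_on[OF cnt] by (auto intro: comp_inj_on inj_on_subset)
  let ?C = "alg_copy t ?B"
  have C: "is_algebra ?C" using is_algebra_alg_copy[OF _ B] inj by (simp add: univ)
  have univC: "univ ?C = t ` S" by (simp add: alg_copy_def univ)
  have pull: "(\<lambda>a\<in>S. x (t a)) \<in> alg_hom ?B A" if "x \<in> alg_hom ?C A" for x
  proof -
    have "restrict t S \<in> alg_hom ?B ?C" using alg_copy_hom[OF _ B] inj by (simp add: univ)
    from alg_hom_compose[OF this that B] show ?thesis by (simp add: univ cong: restrict_cong)
  qed
  have proj: "\<exists>x\<in>alg_hom ?C A. \<forall>a\<in>S. x (t a) = a p" if p: "p \<in> I" for p
  proof -
    have "restrict (inv_into S t) (t ` S) \<in> alg_hom ?C ?B"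
      using alg_copy_inv_hom[OF _ B] inj by (simp add: univ)
    from alg_hom_compose[OF this projection_alg_hom[OF S p] C] show ?thesis
      using inj by (intro bexI) (auto simp: univC)
  qed
  have ISP: "?C \<in> ISP A"
  proof (rule ISP_if_separated[OF C])
    show "arity ?C = arity A" by (simp add: alg_copy_def subalg_def direct_power_def)
    fix a b assume ab: "a \<in> univ ?C" "b \<in> univ ?C" "a \<noteq> b"
    then obtain f g where fg: "f \<in> S" "g \<in> S" "a = t f" "b = t g" "f \<noteq> g" by (auto simp: univC)
    have ex: "f \<in> extensional I" "g \<in> extensional I"
      using fg S by (auto simp: subuniverse_def direct_power_def PiE_def)
    have "\<exists>p\<in>I. f p \<noteq> g p"
      using extensionalityI[OF ex] fg(5) by blast
    thus "\<exists>x\<in>alg_hom ?C A. x a \<noteq> x b" using proj fg by metis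
  qed
  show ?thesis
  proof (rule not_dualizable_if_ghost[OF ISP])
    show "t (c i) \<in> univ ?C" for i using c by (simp add: univC)
    show "\<exists>k::nat. \<forall>i j. i \<noteq> k \<longrightarrow> j \<noteq> k \<longrightarrow> x (t (c i)) = x (t (c j))"
      if "x \<in> alg_hom ?C A" for x
      using almost[OF pull[OF that]] c by simp
    fix b assume "b \<in> univ ?C"
    then obtain f where f: "f \<in> S" "b = t f" by (auto simp: univC)
    from ghost[OF f(1)] obtain p where p: "p \<in> I" "infinite {i. c i p \<noteq> f p}" by blast
    from proj[OF p(1)] obtain x where x: "x \<in> alg_hom ?C A" "\<forall>a\<in>S. x (t a) = a p" by blast
    have "{i. x (t (c i)) \<noteq> x b} = {i. c i p \<noteq> f p}" using x(2) f c by auto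
    thus "\<exists>x\<in>alg_hom ?C A. infinite {i. x (t (c i)) \<noteq> x b}" using x(1) p(2) by metis
  qed
qed

section \<open>The ring of even integers modulo 8\<close>

lemma univ_two_Z8: "a \<in> univ two_Z8 \<longleftrightarrow> 0 \<le> a \<and> a < 8 \<and> even a"
proof -
  have "a = 0 \<or> a = 2 \<or> a = 4 \<or> a = 6" if "0 \<le> a" "a < 8" "even a"
    using that by presburger
  thus ?thesis by (auto simp: two_Z8_def subalg_def)
qed

lemma arity_two_Z8:
  "arity two_Z8 Plus = 2" "arity two_Z8 Times = 2" "arity two_Z8 Zero = 0"
  by (simp_all add: two_Z8_def subalg_def integers_mod_def)

lemma oper_two_Z8:
  "oper two_Z8 Plus v = (v 0 + v 1) mod 8" "oper two_Z8 Times v = (v 0 * v 1) mod 8"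
  "oper two_Z8 Zero v = 0"
  by (simp_all add: two_Z8_def subalg_def integers_mod_def)

lemma subuniverse_power_two_Z8:
  assumes "S \<subseteq> UNIV \<rightarrow>\<^sub>E univ two_Z8"
    and "\<And>f g. f \<in> S \<Longrightarrow> g \<in> S \<Longrightarrow> (\<lambda>p. (f p + g p) mod 8) \<in> S"
    and "\<And>f g. f \<in> S \<Longrightarrow> g \<in> S \<Longrightarrow> (\<lambda>p. (f p * g p) mod 8) \<in> S"
    and "(\<lambda>p. 0) \<in> S"
  shows "subuniverse S (direct_power two_Z8 UNIV)"
  unfolding subuniverse_def
proof (intro conjI allI ballI)
  show "S \<subseteq> univ (direct_power two_Z8 UNIV)" using assms(1) by (simp add: direct_power_def)
  fix s v assume v: "v \<in> {..<arity (direct_power two_Z8 UNIV) s} \<rightarrow>\<^sub>E S"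
  show "oper (direct_power two_Z8 UNIV) s v \<in> S"
  proof (cases s)
    case Plus
    hence v2: "v \<in> {..<2} \<rightarrow>\<^sub>E S" using v by (simp add: direct_power_def arity_two_Z8)
    have "v 0 \<in> S" "v 1 \<in> S" using PiE_mem[OF v2, of 0] PiE_mem[OF v2, of 1] by simp_all
    from assms(2)[OF this] show ?thesis
      by (simp add: Plus direct_power_def arity_two_Z8 oper_two_Z8 restrict_UNIV)
  next
    case Times
    hence v2: "v \<in> {..<2} \<rightarrow>\<^sub>E S" using v by (simp add: direct_power_def arity_two_Z8)
    have "v 0 \<in> S" "v 1 \<in> S" using PiE_mem[OF v2, of 0] PiE_mem[OF v2, of 1] by simp_all
    from assms(3)[OF this] show ?thesis
      by (simp add: Times direct_power_def arity_two_Z8 oper_two_Z8 restrict_UNIV)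
  next
    case Zero
    thus ?thesis using assms(4) by (simp add: direct_power_def oper_two_Z8 restrict_UNIV)
  qed
qed

lemma alg_hom_two_Z8:
  assumes x: "x \<in> alg_hom (subalg (direct_power two_Z8 UNIV) S) two_Z8"
    and fg: "f \<in> S" "g \<in> S"
  shows alg_hom_two_Z8_plus: "x (\<lambda>p. (f p + g p) mod 8) = (x f + x g) mod 8"
    and alg_hom_two_Z8_times: "x (\<lambda>p. (f p * g p) mod 8) = (x f * x g) mod 8"
proof -
  let ?B = "subalg (direct_power two_Z8 UNIV) S"
  define v where "v = (\<lambda>k\<in>{..<2::nat}. if k = 0 then f else g)"
  have v: "v \<in> {..<arity ?B Plus} \<rightarrow>\<^sub>E univ ?B" "v \<in> {..<arity ?B Times} \<rightarrow>\<^sub>E univ ?B"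
    using fg by (auto simp: v_def subalg_def direct_power_def arity_two_Z8)
  show "x (\<lambda>p. (f p + g p) mod 8) = (x f + x g) mod 8"
    using alg_hom_oper[OF x v(1)]
    by (simp add: subalg_def direct_power_def arity_two_Z8 oper_two_Z8 v_def restrict_UNIV)
  show "x (\<lambda>p. (f p * g p) mod 8) = (x f * x g) mod 8"
    using alg_hom_oper[OF x v(2)]
    by (simp add: subalg_def direct_power_def arity_two_Z8 oper_two_Z8 v_def restrict_UNIV)
qed

text \<open>Counted in units of \<open>4\<close>, the defect of \<open>f\<close> from being constantly \<open>a\<close> higher on the upper level
  has even total; the limit of the ghost sequence has total defect one.\<close>

definition tame :: "int \<Rightarrow> nat \<Rightarrow> (bool \<times> nat \<Rightarrow> int) \<Rightarrow> bool" where
  "tame a n f \<longleftrightarrow> (\<forall>j\<ge>n. f (False, j) = 0 \<and> f (True, j) = a) \<and>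
     (\<forall>j. 4 dvd f (True, j) - f (False, j) - a) \<and>
     4 dvd (\<Sum>j<n. f (False, j)) \<and> 8 dvd (\<Sum>j<n. f (True, j) - f (False, j) - a)"

definition tame_ring :: "(bool \<times> nat \<Rightarrow> int) set" where
  "tame_ring = {f. range f \<subseteq> univ two_Z8 \<and> (\<exists>a n. tame a n f)}"

text \<open>Beyond \<open>n\<close> the summands vanish, so both sums are unchanged. This allows two
  tame functions to share a bound.\<close>

lemma tame_mono:
  assumes f: "tame a n f" and "n \<le> m"
  shows "tame a m f"
proof -
  have "sum h {..<m} = sum h {..<n}" if "\<And>j. j \<ge> n \<Longrightarrow> h j = 0" for h :: "nat \<Rightarrow> int"
    using that \<open>n \<le> m\<close> by (intro sum.mono_neutral_right) auto
  from this[of "\<lambda>j. f (False, j)"] this[of "\<lambda>j. f (True, j) - f (False, j) - a"]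
  show ?thesis using f \<open>n \<le> m\<close> by (simp add: tame_def)
qed

lemma tame_even:
  assumes "range f \<subseteq> univ two_Z8" "tame a n f"
  shows "even (f p)" "even a"
proof -
  show e: "even (f p)" for p using assms(1) univ_two_Z8[of "f p"] by blast
  have "a = f (True, n)" using assms(2) by (simp add: tame_def)
  thus "even a" using e by simp
qed

text \<open>Serves to replace summands reduced modulo 8 by simpler congruent ones.\<close>

lemma dvd_sum_cong:
  fixes u v :: "'i \<Rightarrow> int"
  assumes "d dvd sum v I" "\<And>i. d dvd u i - v i"
  shows "d dvd sum u I"
proof -
  have "d dvd (\<Sum>i\<in>I. u i - v i)" using assms(2) by (intro dvd_sum)
  from dvd_add[OF this assms(1)] show ?thesis by (simp add: sum_subtractf)
qed

lemma dvd_8_mod: "(8::int) dvd x mod 8 - x" "(4::int) dvd x mod 8 - x"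
  by presburger+

lemma dvd_8_mod_diff:
  fixes x y z w :: int
  assumes "8 dvd x - y - z - w"
  shows "8 dvd x mod 8 - y mod 8 - z mod 8 - w"
proof -
  have "x mod 8 - y mod 8 - z mod 8 - w =
      (x - y - z - w) - 8 * (x div 8 - y div 8 - z div 8)"
    by (simp add: minus_mult_div_eq_mod [symmetric] algebra_simps)
  thus ?thesis using dvd_diff[OF assms dvd_triv_left] by (simp only:)
qed

text \<open>Defects add up, and reduction modulo 8 changes them only by multiples of 8.\<close>

lemma tame_plus:
  assumes f: "tame a n f" and g: "tame b n g"
  shows "tame ((a + b) mod 8) n (\<lambda>p. (f p + g p) mod 8)"
  unfolding tame_def
proof (intro conjI allI impI)
  show "(f (False, j) + g (False, j)) mod 8 = 0" "(f (True, j) + g (True, j)) mod 8 = (a + b) mod 8"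
    if "n \<le> j" for j using f g that by (simp_all add: tame_def)
  have d: "8 dvd (f (True, j) + g (True, j)) mod 8 - (f (False, j) + g (False, j)) mod 8 -
      (a + b) mod 8 - ((f (True, j) - f (False, j) - a) + (g (True, j) - g (False, j) - b))" for j
    by (rule dvd_8_mod_diff) simp
  show "4 dvd (f (True, j) + g (True, j)) mod 8 - (f (False, j) + g (False, j)) mod 8 -
      (a + b) mod 8" for j
  proof -
    have "4 dvd f (True, j) - f (False, j) - a" "4 dvd g (True, j) - g (False, j) - b"
      using f g by (auto simp: tame_def)
    hence "4 dvd (f (True, j) - f (False, j) - a) + (g (True, j) - g (False, j) - b)"
      by (rule dvd_add)
    moreover have "4 dvd u" if "8 dvd u - v" "4 dvd v" for u v :: int
      using that by presburger
    ultimately show ?thesis using d[of j] by blast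
  qed
  have "4 dvd (\<Sum>j<n. f (False, j) + g (False, j))"
    using f g by (simp add: tame_def sum.distrib)
  thus "4 dvd (\<Sum>j<n. (f (False, j) + g (False, j)) mod 8)"
    by (rule dvd_sum_cong) (rule dvd_8_mod)
  have "8 dvd (\<Sum>j<n. (f (True, j) - f (False, j) - a) + (g (True, j) - g (False, j) - b))"
    using f g unfolding tame_def sum.distrib by simp
  thus "8 dvd (\<Sum>j<n. (f (True, j) + g (True, j)) mod 8 - (f (False, j) + g (False, j)) mod 8 -
      (a + b) mod 8)"
    by (rule dvd_sum_cong) (rule d)
qed

text \<open>A product of two even numbers only depends on the factors modulo \<open>4\<close>, so on the upper level
  \<open>f * g\<close> equals \<open>(f + a) * (g + b)\<close> computed from the lower level.\<close>

lemma tame_times: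
  assumes f: "tame a n f" "range f \<subseteq> univ two_Z8" and g: "tame b n g" "range g \<subseteq> univ two_Z8"
  shows "tame ((a * b) mod 8) n (\<lambda>p. (f p * g p) mod 8)"
  unfolding tame_def
proof (intro conjI allI impI)
  note ev = tame_even[OF f(2,1)] tame_even[OF g(2,1)]
  show "(f (False, j) * g (False, j)) mod 8 = 0" "(f (True, j) * g (True, j)) mod 8 = (a * b) mod 8"
    if "n \<le> j" for j using f g that by (simp_all add: tame_def)
  \<comment> \<open>Modulo 8 the defect of the product is the cross term of
    \<open>(f + a) * (g + b)\<close>, which is linear in the lower-level values.\<close>
  have d: "8 dvd (f (True, j) * g (True, j)) mod 8 - (f (False, j) * g (False, j)) mod 8 -
      (a * b) mod 8 - (b * f (False, j) + a * g (False, j))" for j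
  proof -
    have "4 dvd f (True, j) - f (False, j) - a" using f by (auto simp: tame_def)
    then obtain k where "f (True, j) - f (False, j) - a = 4 * k" by blast
    hence k: "f (True, j) = f (False, j) + a + 4 * k" by simp
    have "4 dvd g (True, j) - g (False, j) - b" using g by (auto simp: tame_def)
    then obtain l where "g (True, j) - g (False, j) - b = 4 * l" by blast
    hence l: "g (True, j) = g (False, j) + b + 4 * l" by simp
    obtain p q r s where e: "f (False, j) = 2 * p" "g (False, j) = 2 * q" "a = 2 * r" "b = 2 * s"
      using ev by (meson evenE)
    have "f (True, j) * g (True, j) - f (False, j) * g (False, j) - a * b -
        (b * f (False, j) + a * g (False, j)) = 8 * (k * (q + s) + l * (p + r) + 2 * k * l)"
      unfolding k l e by (simp add: algebra_simps)
    hence "8 dvd f (True, j) * g (True, j) - f (False, j) * g (False, j) - a * b -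
        (b * f (False, j) + a * g (False, j))" by simp
    thus ?thesis by (rule dvd_8_mod_diff)
  qed
  have e4: "4 dvd x * y" if "even x" "even y" for x y :: int
    using mult_dvd_mono[OF that] by simp
  have e4m: "4 dvd (x * y) mod 8" if "even x" "even y" for x y :: int
    using e4[OF that] by presburger
  show "4 dvd (f (True, j) * g (True, j)) mod 8 - (f (False, j) * g (False, j)) mod 8 -
      (a * b) mod 8" for j
    using ev by (intro dvd_diff e4m)
  show "4 dvd (\<Sum>j<n. (f (False, j) * g (False, j)) mod 8)"
    using ev by (intro dvd_sum e4m)
  \<comment> \<open>The purpose of requiring lower-level sums divisible by 4: multiplied by the even
    constants \<open>a\<close> and \<open>b\<close>, they make the total cross term divisible by
    8.\<close>
  have "2 * 4 dvd b * (\<Sum>j<n. f (False, j))" "2 * 4 dvd a * (\<Sum>j<n. g (False, j))"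
    using f(1) g(1) ev by (auto simp only: tame_def intro!: mult_dvd_mono)
  hence "8 dvd (\<Sum>j<n. b * f (False, j) + a * g (False, j))"
    by (simp add: sum.distrib sum_distrib_left)
  thus "8 dvd (\<Sum>j<n. (f (True, j) * g (True, j)) mod 8 - (f (False, j) * g (False, j)) mod 8 -
      (a * b) mod 8)"
    by (rule dvd_sum_cong) (rule d)
qed

section \<open>Closure and countability of the subring\<close>

lemma zero_tame_ring: "(\<lambda>p. 0) \<in> tame_ring"
proof -
  have "tame 0 0 (\<lambda>p. 0)" by (simp add: tame_def)
  thus ?thesis by (auto simp: tame_ring_def univ_two_Z8)
qed

lemma tame_ring_closed:
  assumes fg: "f \<in> tame_ring" "g \<in> tame_ring"
  shows plus_tame_ring: "(\<lambda>p. (f p + g p) mod 8) \<in> tame_ring"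
    and times_tame_ring: "(\<lambda>p. (f p * g p) mod 8) \<in> tame_ring"
proof -
  from fg obtain a n b m where "tame a n f" "tame b m g" by (auto simp: tame_ring_def)
  hence t: "tame a (max n m) f" "tame b (max n m) g" by (auto intro: tame_mono)
  have r: "range f \<subseteq> univ two_Z8" "range g \<subseteq> univ two_Z8" using fg by (auto simp: tame_ring_def)
  have e: "even (f p)" "even (g p)" for p using tame_even(1) r t by blast+
  have "even (x mod 8)" if "even x" for x :: int using that by presburger
  hence "(f p + g p) mod 8 \<in> univ two_Z8" "(f p * g p) mod 8 \<in> univ two_Z8" for p
    using e[of p] by (simp_all add: univ_two_Z8)
  thus "(\<lambda>p. (f p + g p) mod 8) \<in> tame_ring" "(\<lambda>p. (f p * g p) mod 8) \<in> tame_ring"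
    using tame_plus[OF t] tame_times[OF t(1) r(1) t(2) r(2)] unfolding tame_ring_def by blast+
qed

lemma subuniverse_tame_ring: "subuniverse tame_ring (direct_power two_Z8 UNIV)"
  using plus_tame_ring times_tame_ring zero_tame_ring
  by (intro subuniverse_power_two_Z8) (auto simp: tame_ring_def)

text \<open>A tame function is coded by its eventual upper value \<open>a\<close> and two finite
  lists, its first \<open>n\<close> values on each level.\<close>

lemma countable_tame_ring: "countable tame_ring"
proof (rule countable_subset)
  let ?F = "\<lambda>(a :: int, l, l') (s, j). if j < length l then (if s then l' ! j else l ! j)
    else if s then a else 0"
  show "tame_ring \<subseteq> range ?F"
  proof
    fix f assume "f \<in> tame_ring"
    then obtain a n where "tame a n f" by (auto simp: tame_ring_def)
    hence "f = ?F (a, map (\<lambda>j. f (False, j)) [0..<n], map (\<lambda>j. f (True, j)) [0..<n])"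
      by (auto simp: fun_eq_iff tame_def)
    thus "f \<in> range ?F" by blast
  qed
qed auto

text \<open>Two indices satisfying \<open>P\<close> and two violating it cannot coexist, so one of
  the two classes has at most one member, which serves as \<open>k\<close>.\<close>

lemma at_most_one_exception:
  assumes "\<And>i i' l l'. \<lbrakk>P i; P i'; i \<noteq> i'; \<not> P l; \<not> P l'\<rbrakk> \<Longrightarrow> l = l'"
  shows "\<exists>k. \<forall>i j. i \<noteq> k \<longrightarrow> j \<noteq> k \<longrightarrow> P i = P j"
  using assms by metis

section \<open>The ghost sequence\<close>

definition level :: "bool \<times> nat \<Rightarrow> int" where
  "level p = (if fst p then 2 else 0)"

text \<open>These are the \<open>w\<^sub>i\<close>. The point over \<open>0\<close> is shared and
  survives in the limit. The moving point over \<open>Suc i\<close> brings the lower-level sum to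
  \<open>4\<close>, as tameness demands.\<close>

definition wedge :: "nat \<Rightarrow> bool \<times> nat \<Rightarrow> int" where
  "wedge i p = (if snd p = 0 \<or> snd p = Suc i then 2 else 0)"

definition ghost_seq :: "nat \<Rightarrow> bool \<times> nat \<Rightarrow> int" where
  "ghost_seq i p = (level p * wedge i p) mod 8"

lemma level_tame_ring: "level \<in> tame_ring"
proof -
  have "tame 2 0 level" by (simp add: tame_def level_def)
  thus ?thesis by (auto simp: tame_ring_def level_def univ_two_Z8)
qed

lemma wedge_tame_ring: "wedge i \<in> tame_ring"
proof -
  have "(\<Sum>j<Suc (Suc i). wedge i (False, j)) = 4"
  proof -
    have "wedge i (False, j) = (if j = 0 then 2 else 0) + (if j = Suc i then 2 else 0)" for j
      by (simp add: wedge_def)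
    thus ?thesis by (simp add: sum.distrib del: sum.lessThan_Suc)
  qed
  \<comment> \<open>The two levels agree, so all defects vanish. The bound lies just past the moving
    point \<open>Suc i\<close>.\<close>
  hence "tame 0 (Suc (Suc i)) (wedge i)" by (auto simp: tame_def wedge_def)
  thus ?thesis by (auto simp: tame_ring_def wedge_def univ_two_Z8)
qed

lemma ghost_seq_almost_constant:
  assumes x: "x \<in> alg_hom (subalg (direct_power two_Z8 UNIV) tame_ring) two_Z8"
  shows "\<exists>k. \<forall>i j. i \<noteq> k \<longrightarrow> j \<noteq> k \<longrightarrow> x (ghost_seq i) = x (ghost_seq j)"
proof -
  note plus = alg_hom_two_Z8_plus[OF x] and times = alg_hom_two_Z8_times[OF x]
  have even: "even (x f)" if "f \<in> tame_ring" for f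
    using alg_hom_in[OF x] that by (auto simp: subalg_def univ_two_Z8)
  have "x (\<lambda>p. 0) = (x (\<lambda>p. 0) + x (\<lambda>p. 0)) mod 8"
    using plus[OF zero_tame_ring zero_tame_ring] by simp
  moreover have "0 \<le> x (\<lambda>p. 0)" "x (\<lambda>p. 0) < 8"
    using alg_hom_in[OF x, of "\<lambda>p. 0"] zero_tame_ring by (auto simp: subalg_def univ_two_Z8)
  ultimately have zero: "x (\<lambda>p. 0) = 0" by presburger
  define P where "P i \<longleftrightarrow> 4 dvd x (wedge i)" for i
  have "l = l'" if P: "P i" "P i'" "i \<noteq> i'" "\<not> P l" "\<not> P l'" for i i' l l'
  proof (rule ccontr)
    assume "l \<noteq> l'"
    let ?s = "\<lambda>i l p. (wedge i p + wedge l p) mod 8"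
    have s_in: "?s i l \<in> tame_ring" for i l
      by (intro plus_tame_ring wedge_tame_ring)
    \<comment> \<open>Over \<open>0\<close> the product is \<open>4 * 4\<close>, which vanishes
      modulo 8. Elsewhere the supports are disjoint, because \<open>P\<close> distinguishes
      \<open>i\<close>, \<open>i'\<close> from \<open>l\<close>, \<open>l'\<close>.\<close>
    have "(\<lambda>p. (?s i l p * ?s i' l' p) mod 8) = (\<lambda>p. 0)"
      using P \<open>l \<noteq> l'\<close> by (auto simp: wedge_def fun_eq_iff)
    moreover have "x (\<lambda>p. (?s i l p * ?s i' l' p) mod 8) = (x (?s i l) * x (?s i' l')) mod 8"
      by (rule times[OF s_in s_in])
    ultimately have prod: "(x (?s i l) * x (?s i' l')) mod 8 = 0" by (simp only: zero)
    have s: "\<exists>q. x (?s i l) = 4 * q + 2" if il: "P i" "\<not> P l" for i l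
    proof -
      have "\<exists>q. (a + b) mod 8 = 4 * q + 2" if "4 dvd a" "\<not> 4 dvd b" "even b" for a b :: int
        using that by presburger
      from this[OF il[unfolded P_def] even[OF wedge_tame_ring]]
      show ?thesis unfolding plus[OF wedge_tame_ring wedge_tame_ring] .
    qed
    obtain q r where qr: "x (?s i l) = 4 * q + 2" "x (?s i' l') = 4 * r + 2"
      using s[OF P(1,4)] s[OF P(2,5)] by blast
    \<comment> \<open>A product of two numbers congruent to 2 modulo 4 is congruent to 4 modulo 8,
      contradicting \<open>prod\<close>.\<close>
    have "(4 * q + 2) * (4 * r + 2) = 8 * (2 * q * r + q + r) + 4"
      by (simp add: algebra_simps)
    with prod have "(8 * (2 * q * r + q + r) + 4) mod 8 = 0" unfolding qr by (simp only:)
    thus False by presburger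
  qed
  hence "\<exists>k. \<forall>i j. i \<noteq> k \<longrightarrow> j \<noteq> k \<longrightarrow> P i = P j"
    by (rule at_most_one_exception)
  then obtain k where k: "\<forall>i j. i \<noteq> k \<longrightarrow> j \<noteq> k \<longrightarrow> P i = P j" by blast
  have "x (ghost_seq i) = x (ghost_seq j)" if "P i = P j" for i j
  proof -
    \<comment> \<open>The even factor \<open>x level\<close> lifts agreement of the wedge values
      modulo 4 to agreement of the products modulo 8.\<close>
    obtain m where m: "x level = 2 * m" using even[OF level_tame_ring] by blast
    have "4 dvd a - b" if "4 dvd a \<longleftrightarrow> 4 dvd b" "even a" "even b" for a b :: int
      using that by presburger
    from this[OF that[unfolded P_def] even[OF wedge_tame_ring] even[OF wedge_tame_ring]]
    have "4 dvd x (wedge i) - x (wedge j)" .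
    then obtain r where r: "x (wedge i) - x (wedge j) = 4 * r" by blast
    hence "x level * x (wedge i) = x level * x (wedge j) + 8 * (m * r)"
      by (simp add: m algebra_simps)
    hence "(x level * x (wedge i)) mod 8 = (x level * x (wedge j)) mod 8" by simp
    thus ?thesis
      unfolding ghost_seq_def[abs_def] times[OF level_tame_ring wedge_tame_ring] .
  qed
  thus ?thesis using k by blast
qed

lemma ghost_not_in_tame_ring:
  assumes "f \<in> tame_ring"
  shows "\<exists>p. f p \<noteq> (if p = (True, 0) then 4 else 0)"
proof (rule ccontr)
  assume "\<not> ?thesis"
  hence f: "f p = (if p = (True, 0) then 4 else 0)" for p by blast
  obtain a n where t: "tame a n f" using assms by (auto simp: tame_ring_def)
  \<comment> \<open>Enlarging the bound ensures that index \<open>0\<close> occurs in the sum even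
    when \<open>n = 0\<close>, and that the eventual value is read off away from
    \<open>0\<close>.\<close>
  have t': "tame a (Suc n) f" by (rule tame_mono[OF t]) simp
  have "f (True, Suc n) = a" using t' unfolding tame_def by blast
  hence a: "a = 0" by (simp add: f)
  have "8 dvd (\<Sum>j<Suc n. f (True, j) - f (False, j) - a)" using t' by (simp add: tame_def)
  moreover have "(\<Sum>j<Suc n. f (True, j) - f (False, j) - a) = 4"
    unfolding sum.lessThan_Suc_shift by (simp add: f a)
  ultimately show False by simp
qed

theorem mainTheorem2:
  assumes "infinite (UNIV :: 'b set)"
  shows "\<not> dualizable TYPE('b) two_Z8"
proof (rule not_dualizable_if_ghost_in_power[OF assms countable_tame_ring subuniverse_tame_ring,
    where c = ghost_seq])
  show "ghost_seq i \<in> tame_ring" for i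
    unfolding ghost_seq_def[abs_def] by (intro times_tame_ring level_tame_ring wedge_tame_ring)
next
  show "\<exists>k. \<forall>i j. i \<noteq> k \<longrightarrow> j \<noteq> k \<longrightarrow> x (ghost_seq i) = x (ghost_seq j)"
    if "x \<in> alg_hom (subalg (direct_power two_Z8 UNIV) tame_ring) two_Z8" for x
    by (rule ghost_seq_almost_constant[OF that])
  fix b assume "b \<in> tame_ring"
  from ghost_not_in_tame_ring[OF this] obtain p
    where p: "b p \<noteq> (if p = (True, 0) then 4 else 0)" by blast
  \<comment> \<open>At a fixed point only the index whose moving point lies over
    \<open>snd p\<close> can deviate from the limit. Every \<open>i \<ge> snd p\<close> avoids it,
    hence the infinite set of disagreements with \<open>b\<close> at \<open>p\<close>.\<close>
  have "ghost_seq i p = (if p = (True, 0) then 4 else 0)" if "Suc i \<noteq> snd p" for i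
    using that by (cases p) (auto simp: ghost_seq_def level_def wedge_def)
  hence "{snd p..} \<subseteq> {i. ghost_seq i p \<noteq> b p}" using p by force
  thus "\<exists>p\<in>UNIV. infinite {i. ghost_seq i p \<noteq> b p}"
    using infinite_Ici infinite_super by blast
qed

end
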